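(* Let $(T_n)_{n\in\mathbb{Z}}$ be the Tribonacci numbers, and for an integer $t$ let $\lambda_1(t)=\alpha^t+\beta^t+\gamma^t$, $\lambda_2(t)=-(\alpha\beta)^t-(\alpha\gamma)^t-(\beta\gamma)^t$, $\lambda_3(t)=(\alpha\beta\gamma)^t$, where $\alpha,\beta,\gamma$ are the three complex roots of $x^3-x^2-x-1$. For every complex number $x$, all integers $t$ and $r$, and every non-negative integer $k$, $$\begin{aligned} \left(1-\lambda_1(t)x-\lambda_2(t)x^2-\lambda_3(t)x^3\right)\sum_{j=0}^{k} x^j T_{tj+r} ={}& T_r + \left(x\lambda_2(t)+x^2\lambda_3(t)\right)T_{r-t} + x\lambda_3(t)T_{r-2t}\\ &- x^{k+1}T_{(k+1)t+r} - x^{k+2}\left(\lambda_2(t)+x\lambda_3(t)\right)T_{kt+r}\\ &- x^{k+2}\lambda_3(t)T_{(k-1)t+r}. \end{aligned}$$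
   Context: The Tribonacci numbers are defined by $T_0=0$, $T_1=T_2=1$ and $T_m=T_{m-1}+T_{m-2}+T_{m-3}$ for $m\ge 3$. They are extended to negative subscripts by $T_{-m}=2T_{-m+3}-T_{-m+4}$ for $m\ge 1$; equivalently, $(T_n)_{n\in\mathbb{Z}}$ is the unique two-sided integer sequence with $T_0=0$, $T_1=T_2=1$ satisfying $T_n=T_{n-1}+T_{n-2}+T_{n-3}$ for all $n\in\mathbb{Z}$. The polynomial $x^3-x^2-x-1$ is the characteristic polynomial of the Tribonacci sequence. The convention $x^0=1$ is used, including for $x=0$. *)

theory Defs
  imports Complex_Main "HOL-Computational_Algebra.Polynomial"
begin

(* On negative arguments: T_(-m) = 2 T_(-m+3) - T_(-m+4) for m >= 1, with n = -m. *)
function trib :: "int \<Rightarrow> int" where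
  "trib n =
    (if n < 0 then 2 * trib (n + 3) - trib (n + 4)
     else if n = 0 then 0
     else if n \<le> 2 then 1
     else trib (n - 1) + trib (n - 2) + trib (n - 3))"
  by pat_completeness auto
termination
  by (relation "measure (\<lambda>n. nat (if n < 0 then 4 - n else n))") (auto split: if_splits)

declare trib.simps [simp del]

lemma trib_rec: "trib n = trib (n - 1) + trib (n - 2) + trib (n - 3)"
proof -
  have pos: "trib m = trib (m - 1) + trib (m - 2) + trib (m - 3)" if "m \<ge> 3" for m
    using that by (subst trib.simps) simp
  have neg: "trib m = 2 * trib (m + 3) - trib (m + 4)" if "m < 0" for m
    using that by (subst trib.simps) simp
  have "trib (3 - int k) = trib (2 - int k) + trib (1 - int k) + trib (- int k)" for k
  proof (induction k)
    case 0
    show ?case using pos[of 3] by simp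
  next
    case (Suc k)
    have "trib (- int (Suc k)) = 2 * trib (2 - int k) - trib (3 - int k)"
      using neg[of "- int (Suc k)"] by (simp add: algebra_simps)
    with Suc.IH show ?case by (simp add: algebra_simps)
  qed
  from this[of "nat (3 - n)"] show ?thesis
    using pos[of n] by (cases "n \<ge> 3") (auto simp: algebra_simps)
qed

(* The roots of this polynomial are simple, so an equation {z. poly trib_char_poly z = 0} = {a, b, c}
   forces a, b, c to be pairwise distinct: they are the three complex roots. *)
definition trib_char_poly :: "complex poly" where
  "trib_char_poly = monom 1 3 - monom 1 2 - monom 1 1 - 1"

definition lambda1 :: "complex \<Rightarrow> complex \<Rightarrow> complex \<Rightarrow> int \<Rightarrow> complex" where
  "lambda1 \<alpha> \<beta> \<gamma> t = \<alpha> powi t + \<beta> powi t + \<gamma> powi t"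

definition lambda2 :: "complex \<Rightarrow> complex \<Rightarrow> complex \<Rightarrow> int \<Rightarrow> complex" where
  "lambda2 \<alpha> \<beta> \<gamma> t =
    - ((\<alpha> * \<beta>) powi t) - (\<alpha> * \<gamma>) powi t - (\<beta> * \<gamma>) powi t"

definition lambda3 :: "complex \<Rightarrow> complex \<Rightarrow> complex \<Rightarrow> int \<Rightarrow> complex" where
  "lambda3 \<alpha> \<beta> \<gamma> t = (\<alpha> * \<beta> * \<gamma>) powi t"

end

theory Submission
  imports Defs "HOL-Computational_Algebra.Fundamental_Theorem_Algebra"
begin

text \<open>
  The formula is the telescoping of a partial sum against the characteristic polynomial of a
  third-order recurrence. By Binet's formula, \<open>T\<^sub>n\<close> is a linear combination of
  \<open>\<alpha>\<^sup>n\<close>, \<open>\<beta>\<^sup>n\<close> and \<open>\<gamma>\<^sup>n\<close>. Along an arithmetic progression of difference \<open>t\<close> each of the three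
  powers is multiplied, at every step, by one of \<open>\<alpha>\<^sup>t\<close>, \<open>\<beta>\<^sup>t\<close>, \<open>\<gamma>\<^sup>t\<close>, and these are the
  roots of \<open>X\<^sup>3 - \<lambda>\<^sub>1(t) X\<^sup>2 - \<lambda>\<^sub>2(t) X - \<lambda>\<^sub>3(t)\<close>. Hence
  \<open>T\<^bsub>n\<^esub> = \<lambda>\<^sub>1(t) T\<^bsub>n-t\<^esub> + \<lambda>\<^sub>2(t) T\<^bsub>n-2t\<^esub> + \<lambda>\<^sub>3(t) T\<^bsub>n-3t\<^esub>\<close> for every \<open>n\<close>
  (\<open>trib_arith_progression_rec\<close>). Once this is known, only the terms at the two ends of the sum
  survive the multiplication by \<open>1 - \<lambda>\<^sub>1(t) x - \<lambda>\<^sub>2(t) x\<^sup>2 - \<lambda>\<^sub>3(t) x\<^sup>3\<close>, for any sequence with such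
  a recurrence (\<open>weighted_sum_third_order_rec\<close>).

  Binet's formula with explicit coefficients (\<open>trib_Binet\<close>) requires the roots to be distinct. They
  are, since the characteristic polynomial has no root in common with its derivative. Both sides of
  Binet's formula satisfy the two-sided Tribonacci recurrence, so it suffices to compare them at
  \<open>0\<close>, \<open>1\<close> and \<open>2\<close>.
\<close>

lemma poly_trib_char_poly: "poly trib_char_poly z = z ^ 3 - z ^ 2 - z - 1"
  by (simp add: trib_char_poly_def poly_monom)

lemma degree_trib_char_poly: "degree trib_char_poly = 3"
  and lead_coeff_trib_char_poly: "lead_coeff trib_char_poly = 1"
proof -
  have eq: "trib_char_poly = [:-1, -1, -1, 1:]"
    by (simp add: trib_char_poly_def monom_altdef power2_eq_square power3_eq_cube one_pCons)
  show "degree trib_char_poly = 3" "lead_coeff trib_char_poly = 1"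
    by (simp_all add: eq)
qed

text \<open>
  The derivative is \<open>(3 z + 1) (z - 1)\<close>, and the polynomial takes the values \<open>-22/27\<close> and \<open>-2\<close> at its
  zeros.
\<close>

lemma rsquarefree_trib_char_poly: "rsquarefree trib_char_poly"
  unfolding rsquarefree_roots
proof (intro allI notI, elim conjE)
  fix z :: complex
  assume p: "poly trib_char_poly z = 0" and "poly (pderiv trib_char_poly) z = 0"
  then have "3 * z ^ 2 - 2 * z - 1 = 0"
    by (simp add: trib_char_poly_def pderiv_diff pderiv_monom poly_monom)
  then have "(3 * z + 1) * (z - 1) = 0"
    by (simp add: algebra_simps power2_eq_square)
  then consider "z = -1/3" | "z = 1"
    by (metis add_eq_0_iff2 eq_iff_diff_eq_0 mult_eq_0_iff nonzero_mult_div_cancel_left zero_neq_numeral)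
  then show False
    using p by cases (simp_all add: poly_trib_char_poly power2_eq_square power3_eq_cube)
qed

text \<open>
  A squarefree cubic over the complex numbers has three roots, so no two of \<open>\<alpha>\<close>, \<open>\<beta>\<close>, \<open>\<gamma>\<close> coincide; comparing
  the polynomial with its factorisation then gives their sum.
\<close>

lemma trib_roots:
  assumes "{z. poly trib_char_poly z = 0} = {\<alpha>, \<beta>, \<gamma>}"
  shows "\<alpha> \<noteq> \<beta>" "\<alpha> \<noteq> \<gamma>" "\<beta> \<noteq> \<gamma>" "\<alpha> + \<beta> + \<gamma> = 1"
proof -
  have fact: "trib_char_poly = (\<Prod>z\<in>{\<alpha>, \<beta>, \<gamma>}. [:- z, 1:])"
    using complex_poly_decompose_rsquarefree[OF rsquarefree_trib_char_poly]
    by (simp add: assms lead_coeff_trib_char_poly)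
  have "degree (\<Prod>z\<in>{\<alpha>, \<beta>, \<gamma>}. [:- z, 1:]) = card {\<alpha>, \<beta>, \<gamma>}"
    by (subst degree_prod_sum_eq) auto
  then have "card {\<alpha>, \<beta>, \<gamma>} = 3"
    by (simp flip: fact add: degree_trib_char_poly)
  then show distinct: "\<alpha> \<noteq> \<beta>" "\<alpha> \<noteq> \<gamma>" "\<beta> \<noteq> \<gamma>"
    by (auto simp: card_insert_if split: if_splits)
  have "coeff trib_char_poly 2 = - (\<alpha> + \<beta> + \<gamma>)"
    unfolding fact using distinct by (simp add: numeral_2_eq_2)
  moreover have "coeff trib_char_poly 2 = -1"
    by (simp add: trib_char_poly_def)
  ultimately show "\<alpha> + \<beta> + \<gamma> = 1"
    by (metis neg_equal_iff_equal)
qed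

text \<open>
  The recurrence can be solved for its last term as well, so three consecutive zeros propagate in
  both directions.
\<close>

lemma two_sided_trib_rec_eq_0:
  fixes f :: "int \<Rightarrow> complex"
  assumes rec: "\<And>n. f n = f (n - 1) + f (n - 2) + f (n - 3)"
    and init: "f 0 = 0" "f 1 = 0" "f 2 = 0"
  shows "f n = 0"
proof -
  have "f n = 0 \<and> f (n + 1) = 0 \<and> f (n + 2) = 0"
  proof (induction n rule: int_induct[where k = 0])
    case base
    show ?case using init by simp
  next
    case (step1 i)
    then show ?case using rec[of "i + 3"] by (simp add: add.commute)
  next
    case (step2 i)
    have "f (i + 2) = f (i + 1) + f i + f (i - 1)"
      using rec[of "i + 2"] by simp (simp add: add.commute)
    then have "f (i - 1) = f (i + 2) - f (i + 1) - f i"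
      by (simp only: algebra_simps)
    with step2.IH show ?case by (simp add: add.commute)
  qed
  then show ?thesis by simp
qed

lemma powi_trib_rec:
  assumes "poly trib_char_poly z = 0"
  shows "z powi n = z powi (n - 1) + z powi (n - 2) + z powi (n - 3)"
proof -
  have z: "z ^ 3 = z ^ 2 + z + 1" and nz: "z \<noteq> 0"
    using assms by (auto simp: poly_trib_char_poly algebra_simps)
  have shift: "z powi (n - 3 + int i) = z powi (n - 3) * z ^ i" for i
    using nz by (simp add: power_int_add)
  show ?thesis
    using shift[of 1] shift[of 2] shift[of 3] z by (simp add: algebra_simps)
qed

text \<open>
  For \<open>n \<ge> 1\<close> the right-hand side is the complete homogeneous symmetric polynomial of degree
  \<open>n - 1\<close> in the roots, so it is \<open>1\<close> at \<open>n = 1\<close> and \<open>\<alpha> + \<beta> + \<gamma> = 1\<close> at \<open>n = 2\<close>; at \<open>n = 0\<close> it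
  vanishes. These are the initial values of the Tribonacci sequence.
\<close>

lemma trib_Binet:
  assumes roots: "{z. poly trib_char_poly z = 0} = {\<alpha>, \<beta>, \<gamma>}"
  shows "of_int (trib n) = \<alpha> powi (n + 1) / ((\<alpha> - \<beta>) * (\<alpha> - \<gamma>))
           + \<beta> powi (n + 1) / ((\<beta> - \<alpha>) * (\<beta> - \<gamma>)) + \<gamma> powi (n + 1) / ((\<gamma> - \<alpha>) * (\<gamma> - \<beta>))"
    (is "_ = ?B n")
proof -
  note distinct = trib_roots(1-3)[OF roots] and sum = trib_roots(4)[OF roots]
  have root: "poly trib_char_poly \<alpha> = 0" "poly trib_char_poly \<beta> = 0" "poly trib_char_poly \<gamma> = 0"
    using roots by auto
  have rec: "?B m = ?B (m - 1) + ?B (m - 2) + ?B (m - 3)" for m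
    using root[THEN powi_trib_rec, of "m + 1"]
    by (simp add: add_divide_distrib algebra_simps)
  (* the common denominator, up to sign, is the Vandermonde determinant *)
  have nz: "(\<alpha> - \<beta>) * (\<alpha> - \<gamma>) * (\<beta> - \<gamma>) \<noteq> 0"
    using distinct by simp
  have common: "u / ((\<alpha> - \<beta>) * (\<alpha> - \<gamma>)) + v / ((\<beta> - \<alpha>) * (\<beta> - \<gamma>)) + w / ((\<gamma> - \<alpha>) * (\<gamma> - \<beta>))
      = (u * (\<beta> - \<gamma>) - v * (\<alpha> - \<gamma>) + w * (\<alpha> - \<beta>)) / ((\<alpha> - \<beta>) * (\<alpha> - \<gamma>) * (\<beta> - \<gamma>))" for u v w
  proof -
    have "u / ((\<alpha> - \<beta>) * (\<alpha> - \<gamma>)) = u * (\<beta> - \<gamma>) / ((\<alpha> - \<beta>) * (\<alpha> - \<gamma>) * (\<beta> - \<gamma>))"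
      using distinct by simp
    moreover have "v / ((\<beta> - \<alpha>) * (\<beta> - \<gamma>)) = - (v * (\<alpha> - \<gamma>)) / ((\<alpha> - \<beta>) * (\<alpha> - \<gamma>) * (\<beta> - \<gamma>))"
      using distinct by (simp add: divide_simps) (simp add: algebra_simps)
    moreover have "w / ((\<gamma> - \<alpha>) * (\<gamma> - \<beta>)) = w * (\<alpha> - \<beta>) / ((\<alpha> - \<beta>) * (\<alpha> - \<gamma>) * (\<beta> - \<gamma>))"
      using distinct by (simp add: divide_simps) (simp add: algebra_simps)
    ultimately show ?thesis
      by (simp add: add_divide_distrib diff_divide_distrib)
  qed
  have B0: "?B 0 = 0"
    unfolding common by (simp add: algebra_simps)
  have B1: "?B 1 = 1"
    unfolding common using nz
    by (simp add: divide_eq_eq) (simp add: algebra_simps power2_eq_square power3_eq_cube)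
  have B2: "?B 2 = \<alpha> + \<beta> + \<gamma>"
    unfolding common using nz
    by (simp add: divide_eq_eq) (simp add: algebra_simps power2_eq_square power3_eq_cube)
  have "of_int (trib n) - ?B n = 0"
  proof (rule two_sided_trib_rec_eq_0[where f = "\<lambda>n. of_int (trib n) - ?B n"])
    fix m
    show "of_int (trib m) - ?B m = (of_int (trib (m - 1)) - ?B (m - 1))
        + (of_int (trib (m - 2)) - ?B (m - 2)) + (of_int (trib (m - 3)) - ?B (m - 3))"
      unfolding rec[of m] by (subst trib_rec) simp
  qed (simp_all only: B0 B1 B2 sum, simp_all add: trib.simps)
  then show ?thesis
    by simp
qed

text \<open>
  Expanding \<open>(u - \<alpha>\<^sup>t) (u - \<beta>\<^sup>t) (u - \<gamma>\<^sup>t)\<close>, which vanishes at \<open>u = z\<^sup>t\<close>, expresses \<open>u\<^sup>3\<close>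
  through lower powers of \<open>u\<close> with the \<open>\<lambda>\<^sub>i(t)\<close> as coefficients, by Vieta. Multiplying by
  \<open>z\<^bsup>n-3t\<^esup>\<close> gives the recurrence.
\<close>

lemma powi_arith_progression_rec:
  assumes "z \<in> {\<alpha>, \<beta>, \<gamma>}" and nz: "z \<noteq> 0"
  shows "z powi n = lambda1 \<alpha> \<beta> \<gamma> t * z powi (n - t) + lambda2 \<alpha> \<beta> \<gamma> t * z powi (n - 2 * t)
           + lambda3 \<alpha> \<beta> \<gamma> t * z powi (n - 3 * t)"
proof -
  define u where "u = z powi t"
  have cubic: "u ^ 3 = lambda1 \<alpha> \<beta> \<gamma> t * u ^ 2 + lambda2 \<alpha> \<beta> \<gamma> t * u + lambda3 \<alpha> \<beta> \<gamma> t"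
    using assms(1) unfolding u_def lambda1_def lambda2_def lambda3_def
    by (auto simp: power_int_mult_distrib algebra_simps power2_eq_square power3_eq_cube)
  have shift: "z powi (n - 3 * t + int i * t) = z powi (n - 3 * t) * u ^ i" for i
    using nz by (simp add: u_def power_int_add power_int_mult mult.commute[of "int i"])
  have "z powi (n - 2 * t) = z powi (n - 3 * t) * u"
    "z powi (n - t) = z powi (n - 3 * t) * u ^ 2" "z powi n = z powi (n - 3 * t) * u ^ 3"
    using shift[of 1] shift[of 2] shift[of 3] by (simp_all add: algebra_simps)
  then show ?thesis
    by (simp add: cubic algebra_simps)
qed

lemma trib_arith_progression_rec:
  assumes roots: "{z. poly trib_char_poly z = 0} = {\<alpha>, \<beta>, \<gamma>}"
  shows "of_int (trib n) = lambda1 \<alpha> \<beta> \<gamma> t * of_int (trib (n - t))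
           + lambda2 \<alpha> \<beta> \<gamma> t * of_int (trib (n - 2 * t)) + lambda3 \<alpha> \<beta> \<gamma> t * of_int (trib (n - 3 * t))"
proof -
  have "poly trib_char_poly 0 \<noteq> 0"
    by (simp add: poly_trib_char_poly)
  then have nz: "\<alpha> \<noteq> 0" "\<beta> \<noteq> 0" "\<gamma> \<noteq> 0"
    using roots by auto
  have rec: "z powi (n + 1) = lambda1 \<alpha> \<beta> \<gamma> t * z powi (n - t + 1)
      + lambda2 \<alpha> \<beta> \<gamma> t * z powi (n - 2 * t + 1) + lambda3 \<alpha> \<beta> \<gamma> t * z powi (n - 3 * t + 1)"
    if "z \<in> {\<alpha>, \<beta>, \<gamma>}" for z
    using powi_arith_progression_rec[OF that, of "n + 1" t] that nz by (auto simp: algebra_simps)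
  show ?thesis
    unfolding trib_Binet[OF roots] rec[of \<alpha>, simplified] rec[of \<beta>, simplified]
      rec[of \<gamma>, simplified]
    by (simp add: add_divide_distrib algebra_simps)
qed

text \<open>
  For \<open>k \<ge> 2\<close>, read as a polynomial in \<open>x\<close>, the product has coefficient zero at \<open>x\<^sup>j\<close> for
  \<open>3 \<le> j \<le> k\<close>, by the recurrence. The recurrence also expresses the incomplete coefficients of
  \<open>x\<close> and \<open>x\<^sup>2\<close> through the terms of negative index, and that of \<open>x\<^bsup>k+1\<^esup>\<close> as \<open>- a (k + 1)\<close>.
  Induction on \<open>k\<close> does this bookkeeping one term at a time and covers small \<open>k\<close>, where the two
  ends overlap.
\<close>

lemma weighted_sum_third_order_rec:
  fixes a :: "int \<Rightarrow> 'a :: comm_ring_1"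
  assumes rec: "\<And>n. a (n + 1) = p * a n + q * a (n - 1) + s * a (n - 2)"
  shows "(1 - p * x - q * x ^ 2 - s * x ^ 3) * (\<Sum>j=0..k. x ^ j * a (int j))
         = a 0 + (x * q + x ^ 2 * s) * a (-1) + x * s * a (-2)
           - x ^ (k + 1) * a (int k + 1) - x ^ (k + 2) * (q + x * s) * a (int k)
           - x ^ (k + 2) * s * a (int k - 1)"
proof (induction k)
  case 0
  have "a 1 = p * a 0 + q * a (-1) + s * a (-2)"
    using rec[of 0] by simp
  then show ?case
    by (simp add: algebra_simps power2_eq_square power3_eq_cube)
next
  case (Suc k)
  have "a (int k + 2) = p * a (int k + 1) + q * a (int k) + s * a (int k - 1)"
    using rec[of "int k + 1"] by (simp add: add.commute[of 2])
  then show ?case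
    using Suc.IH by (simp add: algebra_simps power2_eq_square power3_eq_cube)
qed

theorem theorem2:
  fixes \<alpha> \<beta> \<gamma> x :: complex and t r :: int and k :: nat
  assumes roots: "{z. poly trib_char_poly z = 0} = {\<alpha>, \<beta>, \<gamma>}"
  shows "(1 - lambda1 \<alpha> \<beta> \<gamma> t * x - lambda2 \<alpha> \<beta> \<gamma> t * x ^ 2 - lambda3 \<alpha> \<beta> \<gamma> t * x ^ 3)
           * (\<Sum>j=0..k. x ^ j * of_int (trib (t * int j + r)))
         = of_int (trib r)
           + (x * lambda2 \<alpha> \<beta> \<gamma> t + x ^ 2 * lambda3 \<alpha> \<beta> \<gamma> t) * of_int (trib (r - t))
           + x * lambda3 \<alpha> \<beta> \<gamma> t * of_int (trib (r - 2 * t))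
           - x ^ (k + 1) * of_int (trib ((int k + 1) * t + r))
           - x ^ (k + 2) * (lambda2 \<alpha> \<beta> \<gamma> t + x * lambda3 \<alpha> \<beta> \<gamma> t) * of_int (trib (int k * t + r))
           - x ^ (k + 2) * lambda3 \<alpha> \<beta> \<gamma> t * of_int (trib ((int k - 1) * t + r))"
proof -
  define a :: "int \<Rightarrow> complex" where "a n = of_int (trib (n * t + r))" for n
  have rec: "a (n + 1) = lambda1 \<alpha> \<beta> \<gamma> t * a n + lambda2 \<alpha> \<beta> \<gamma> t * a (n - 1)
      + lambda3 \<alpha> \<beta> \<gamma> t * a (n - 2)" for n
    using trib_arith_progression_rec[OF roots, of "(n + 1) * t + r" t]
    by (simp add: a_def algebra_simps)
  show ?thesis
    using weighted_sum_third_order_rec[of a, OF rec, of x k]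
    by (simp add: a_def mult.commute[of t])
qed

end
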